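(* Let $A$ and $B$ be two finite groups with identities $e_A,e_B$ and with generating sets $S_A$ and $S_B$, respectively, neither containing the identity, such that $|S_A|=|B|\geqslant 2$. Let $\phi:B\to \mathrm{Aut}(A)$, $b\mapsto\phi_b$, be an action of $B$ on $A$ such that $S_A=x^B$ for some $x\in S_A$, where $x^B=\{\phi_b(x): b\in B\}$ is the orbit of $x$. Let $$S=\{(e_A,b): b\in S_B\}\cup\{(x,e_B)\}\subset A\rtimes_\phi B.$$ Then $S$ generates $A\rtimes_\phi B$. Moreover, if $S_B=S_B^{-1}$ and $x=x^{-1}$, then $S=S^{-1}$ and the Cayley graph $C_{A\rtimes_\phi B}(S)$ is a replacement product of $C_A(S_A)$ and $C_B(S_B)$, i.e. for a suitable labelling of the edges around the vertices of $C_A(S_A)$ it equals $C_A(S_A)\circledR C_B(S_B)$.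
   Context: Cayley graph: for a finite group $\Gamma$ and a subset $S\subset\Gamma$ not containing the identity, $C_\Gamma(S)$ has vertex-set $\Gamma$ and edge-set $\{xy: x^{-1}y\in S,\ x,y\in\Gamma\}$; it is an undirected graph when $S=S^{-1}$. An action of $B$ on $A$ is a group homomorphism $\phi:B\to\mathrm{Aut}(A)$, $\phi(b)=\phi_b$, $\phi(b_1b_2)=\phi_{b_1}\phi_{b_2}$. The semidirect product $A\rtimes_\phi B$ is the set $A\times B$ with operation $(a_1,b_1)*(a_2,b_2)=(a_1\phi_{b_1}(a_2),b_1b_2)$; its identity is $(e_A,e_B)$. Replacement product: let $G_1$ be a $\delta_1$-regular graph and $G_2$ a $\delta_2$-regular graph on $\delta_1$ vertices. For every vertex $y\in V(G_1)$, label the $\delta_1$ edges incident with $y$ bijectively by the vertices of $G_2$; $e_y^i$ denotes the edge at $y$ with label $i\in V(G_2)$ (an edge $yz$ may receive different labels at $y$ and at $z$). The replacement product $G_1\circledR G_2$ (with respect to this labelling) has vertex-set $V(G_1)\times V(G_2)$; two distinct vertices $(y,i)$ and $(z,j)$ are adjacent if and only if either $y=z$ and $ij\in E(G_2)$, or $yz\in E(G_1)$ and $e_y^i=yz=e_z^j$. *)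

theory Defs
  imports
    "Graph_Theory.Pair_Digraph"
    "HOL-Algebra.Group_Action"
    "HOL-Algebra.Generated_Groups"
begin

section \<open>Semidirect products\<close>

definition semidirect_product ::
    "('a, 'm) monoid_scheme \<Rightarrow> ('b \<Rightarrow> 'a \<Rightarrow> 'a) \<Rightarrow> ('b, 'n) monoid_scheme \<Rightarrow> ('a \<times> 'b) monoid"
  where "semidirect_product A \<phi> B =
    \<lparr>carrier = carrier A \<times> carrier B,
     mult = (\<lambda>(a1, b1) (a2, b2). (a1 \<otimes>\<^bsub>A\<^esub> \<phi> b1 a2, b1 \<otimes>\<^bsub>B\<^esub> b2)),
     one = (\<one>\<^bsub>A\<^esub>, \<one>\<^bsub>B\<^esub>)\<rparr>"

lemma group_semidirect_product:
  assumes "group A" "group B" "\<phi> \<in> hom B (AutoGroup A)"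
  shows "group (semidirect_product A \<phi> B)"
proof -
  interpret A: group A by fact
  interpret B: group B by fact
  interpret h: group_hom B "AutoGroup A" \<phi>
    using assms A.AutoGroup by (simp add: group_hom_def group_hom_axioms_def)
  note [simp del] = h.hom_inv h.hom_mult h.hom_one
  have aut: "\<phi> b \<in> auto A" if "b \<in> carrier B" for b
    using h.hom_closed[OF that] by (simp add: AutoGroup_def)
  have cl [simp]: "\<phi> b a \<in> carrier A" if "b \<in> carrier B" "a \<in> carrier A" for a b
    using aut[OF that(1)] that(2) by (auto simp: auto_def hom_def)
  have mult [simp]: "\<phi> b (a \<otimes>\<^bsub>A\<^esub> a') = \<phi> b a \<otimes>\<^bsub>A\<^esub> \<phi> b a'"
    if "b \<in> carrier B" "a \<in> carrier A" "a' \<in> carrier A" for a a' b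
    using aut[OF that(1)] that(2,3) by (auto simp: auto_def hom_def)
  have comp [simp]: "\<phi> (b \<otimes>\<^bsub>B\<^esub> b') a = \<phi> b (\<phi> b' a)"
    if "b \<in> carrier B" "b' \<in> carrier B" "a \<in> carrier A" for a b b'
    using h.hom_mult[OF that(1,2)] aut[OF that(1)] aut[OF that(2)] that(3)
    by (auto simp: AutoGroup_def BijGroup_def auto_def compose_def)
  have one [simp]: "\<phi> \<one>\<^bsub>B\<^esub> a = a" if "a \<in> carrier A" for a
    using h.hom_one that by (simp add: AutoGroup_def BijGroup_def)
  show ?thesis
  proof (rule groupI; clarsimp simp: semidirect_product_def A.m_assoc B.m_assoc)
    fix a b assume ab: "a \<in> carrier A" "b \<in> carrier B"
    show "\<exists>a'\<in>carrier A. \<exists>b'\<in>carrier B. a' \<otimes>\<^bsub>A\<^esub> \<phi> b' a = \<one>\<^bsub>A\<^esub> \<and> b' \<otimes>\<^bsub>B\<^esub> b = \<one>\<^bsub>B\<^esub>"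
      using ab by (intro bexI[of _ "inv\<^bsub>A\<^esub> (\<phi> (inv\<^bsub>B\<^esub> b) a)"] bexI[of _ "inv\<^bsub>B\<^esub> b"]) auto
  qed
qed


section \<open>Cayley graphs\<close>

text \<open>
  The pair (x, y) is the arc from x to y. An undirected graph is, as in the library, a symmetric
  digraph, and a finite simple graph is an instance of \<^locale>\<open>pair_graph\<close>.
\<close>

definition cayley_graph :: "('a, 'm) monoid_scheme \<Rightarrow> 'a set \<Rightarrow> 'a pair_pre_digraph"
  where "cayley_graph G S =
    \<lparr>pverts = carrier G,
     parcs = {(x, y). x \<in> carrier G \<and> y \<in> carrier G \<and> inv\<^bsub>G\<^esub> x \<otimes>\<^bsub>G\<^esub> y \<in> S}\<rparr>"


section \<open>Replacement products\<close>

text \<open>Undirected edges are unordered pairs, so that one edge can be labelled at both of its ends.\<close>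

definition incident_edges :: "'a pair_pre_digraph \<Rightarrow> 'a \<Rightarrow> 'a set set"
  where "incident_edges G y = {{y, z} | z. (y, z) \<in> parcs G}"

definition regular_graph :: "nat \<Rightarrow> 'a pair_pre_digraph \<Rightarrow> bool"
  where "regular_graph d G \<longleftrightarrow>
    pair_graph G \<and> (\<forall>y \<in> pverts G. card (incident_edges G y) = d)"

text \<open>\<^term>\<open>e y i\<close> is the edge at the vertex y of G1 whose label at y is the vertex i of G2.\<close>

definition edge_labelling ::
    "'a pair_pre_digraph \<Rightarrow> 'b pair_pre_digraph \<Rightarrow> ('a \<Rightarrow> 'b \<Rightarrow> 'a set) \<Rightarrow> bool"
  where "edge_labelling G1 G2 e \<longleftrightarrow>
    (\<forall>y \<in> pverts G1. bij_betw (e y) (pverts G2) (incident_edges G1 y))"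

definition replacement_product ::
    "('a \<Rightarrow> 'b \<Rightarrow> 'a set) \<Rightarrow> 'a pair_pre_digraph \<Rightarrow> 'b pair_pre_digraph
      \<Rightarrow> ('a \<times> 'b) pair_pre_digraph"
  where "replacement_product e G1 G2 =
    \<lparr>pverts = pverts G1 \<times> pverts G2,
     parcs = {((y, i), (z, j)).
       (y, i) \<in> pverts G1 \<times> pverts G2 \<and> (z, j) \<in> pverts G1 \<times> pverts G2 \<and> (y, i) \<noteq> (z, j) \<and>
       (y = z \<and> (i, j) \<in> parcs G2 \<or>
        (y, z) \<in> parcs G1 \<and> e y i = {y, z} \<and> e z j = {y, z})}\<rparr>"

definition is_replacement_product ::
    "('a \<times> 'b) pair_pre_digraph \<Rightarrow> 'a pair_pre_digraph \<Rightarrow> 'b pair_pre_digraph \<Rightarrow> bool"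
  where "is_replacement_product H G1 G2 \<longleftrightarrow>
    (\<exists>d1 d2. regular_graph d1 G1 \<and> regular_graph d2 G2 \<and> card (pverts G2) = d1 \<and>
      (\<exists>e. edge_labelling G1 G2 e \<and> H = replacement_product e G1 G2))"

end

theory Submission
  imports Defs
begin

text \<open>
  Write P for the semidirect product. Inside P, conjugation by \<open>(1, b)\<close> acts on the copy of A
  through \<open>\<phi> b\<close>, that is, \<open>(1, b) (a, 1) (1, b)\<^sup>-\<^sup>1 = (\<phi> b a, 1)\<close>
  (\<open>conj_embed\<close>). A subgroup containing S therefore contains the copy of B, hence all conjugates
  \<open>(\<phi> b x, 1)\<close> of \<open>(x, 1)\<close>; these are the copies of the elements of the orbit
  of x, which generate the copy of A, and the two copies together exhaust P. So the single generator
  \<open>(x, 1)\<close> does the work of all of \<open>S\<^sub>A\<close>.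

  For the graphs, right multiplication by \<open>(1, s)\<close> takes \<open>(y, i)\<close> to \<open>(y, i s)\<close>,
  a step of the Cayley graph of B inside the cloud over y, that is, among the vertices with
  first coordinate y, while right multiplication by
  \<open>(x, 1)\<close> takes \<open>(y, i)\<close> to \<open>(y (\<phi> i x), i)\<close>, a step between clouds.
  This dictates the labelling: the edge at y with label i must be the one joining y to
  \<open>y (\<phi> i x)\<close>. The orbit map \<open>i \<mapsto> \<phi> i x\<close> goes from B onto \<open>S\<^sub>A\<close>, and
  these sets have the same finite size, so it is injective and the labelling is bijective at every
  vertex (\<open>bij_betw_orbit\<close>, \<open>edge_labelling_orbit\<close>). Since x is an involution, so is
  \<open>\<phi> i x\<close>, and the edge with label i at y also has label i at its other end. The edges of the
  replacement product between distinct clouds thus never change the second coordinate, just as in the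
  Cayley graph of P (\<open>cayley_graph_semidirect_product\<close>).
\<close>

section \<open>Cayley graphs\<close>

context group
begin

lemma arc_cayley_graph_iff:
  assumes "S \<subseteq> carrier G"
  shows "(x, y) \<in> parcs (cayley_graph G S) \<longleftrightarrow> x \<in> carrier G \<and> (\<exists>s\<in>S. y = x \<otimes> s)"
proof
  assume "(x, y) \<in> parcs (cayley_graph G S)"
  then have "x \<in> carrier G" "y \<in> carrier G" "inv x \<otimes> y \<in> S"
    by (auto simp: cayley_graph_def)
  moreover from this have "y = x \<otimes> (inv x \<otimes> y)"
    by (simp add: m_assoc [symmetric])
  ultimately show "x \<in> carrier G \<and> (\<exists>s\<in>S. y = x \<otimes> s)"
    by blast
next
  assume "x \<in> carrier G \<and> (\<exists>s\<in>S. y = x \<otimes> s)"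
  with assms show "(x, y) \<in> parcs (cayley_graph G S)"
    by (auto simp: cayley_graph_def m_assoc [symmetric] subset_iff)
qed

lemma pair_graph_cayley_graph:
  assumes "finite (carrier G)" "S \<subseteq> carrier G" "\<one> \<notin> S" and inv: "\<And>s. s \<in> S \<Longrightarrow> inv s \<in> S"
  shows "pair_graph (cayley_graph G S)"
proof
  note arc = arc_cayley_graph_iff [OF assms(2)]
  show "fst e \<in> pverts (cayley_graph G S)" if "e \<in> parcs (cayley_graph G S)" for e
    using that by (auto simp: cayley_graph_def)
  show "snd e \<in> pverts (cayley_graph G S)" if "e \<in> parcs (cayley_graph G S)" for e
    using that by (auto simp: cayley_graph_def)
  show "finite (pverts (cayley_graph G S))"
    using assms(1) by (simp add: cayley_graph_def)
  show "finite (parcs (cayley_graph G S))"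
    by (rule finite_subset [of _ "carrier G \<times> carrier G"]) (auto simp: cayley_graph_def assms(1))
  show "fst e \<noteq> snd e" if "e \<in> parcs (cayley_graph G S)" for e
    using that assms(3) by (auto simp: cayley_graph_def)
  have "(y, x) \<in> parcs (cayley_graph G S)" if xy: "(x, y) \<in> parcs (cayley_graph G S)" for x y
  proof -
    from xy have c: "x \<in> carrier G" "y \<in> carrier G" "inv x \<otimes> y \<in> S"
      by (auto simp: cayley_graph_def)
    from inv [OF c(3)] have "inv y \<otimes> x \<in> S"
      using c by (simp add: inv_mult_group)
    with c show ?thesis
      by (simp add: cayley_graph_def)
  qed
  then show "symmetric (with_proj (cayley_graph G S))"
    by (auto simp: symmetric_def sym_def arcs_ends_def arc_to_ends_def)
qed

lemma bij_betw_incident_edges_cayley_graph: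
  assumes "S \<subseteq> carrier G" "y \<in> carrier G"
  shows "bij_betw (\<lambda>s. {y, y \<otimes> s}) S (incident_edges (cayley_graph G S) y)"
  unfolding bij_betw_def
proof
  show "inj_on (\<lambda>s. {y, y \<otimes> s}) S"
    using assms by (auto intro!: inj_onI simp: doubleton_eq_iff subset_iff)
  show "(\<lambda>s. {y, y \<otimes> s}) ` S = incident_edges (cayley_graph G S) y"
    using assms by (auto simp: incident_edges_def arc_cayley_graph_iff)
qed

lemma regular_graph_cayley_graph:
  assumes "finite (carrier G)" "S \<subseteq> carrier G" "\<one> \<notin> S" "\<And>s. s \<in> S \<Longrightarrow> inv s \<in> S"
  shows "regular_graph (card S) (cayley_graph G S)"
proof -
  have "card (incident_edges (cayley_graph G S) y) = card S"
    if "y \<in> pverts (cayley_graph G S)" for y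
    using that bij_betw_same_card [OF bij_betw_incident_edges_cayley_graph [OF assms(2)], of y]
    by (simp add: cayley_graph_def)
  with pair_graph_cayley_graph [OF assms] show ?thesis
    by (simp add: regular_graph_def)
qed

end

section \<open>Semidirect products\<close>

locale automorphism_action = A: group A + B: group B
  for A :: "('a, 'm) monoid_scheme" and B :: "('b, 'n) monoid_scheme" +
  fixes \<phi> :: "'b \<Rightarrow> 'a \<Rightarrow> 'a"
  assumes action: "\<phi> \<in> hom B (AutoGroup A)"
begin

abbreviation P :: "('a \<times> 'b) monoid"
  where "P \<equiv> semidirect_product A \<phi> B"

lemma auto_action: "b \<in> carrier B \<Longrightarrow> \<phi> b \<in> auto A"
  using hom_in_carrier [OF action] by (simp add: AutoGroup_def)

lemma action_closed [simp]: "\<lbrakk>b \<in> carrier B; a \<in> carrier A\<rbrakk> \<Longrightarrow> \<phi> b a \<in> carrier A"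
  using auto_action by (auto simp: auto_def hom_def)

lemma group_hom_action: "b \<in> carrier B \<Longrightarrow> group_hom A A (\<phi> b)"
  using auto_action by unfold_locales (auto simp: auto_def)

lemma action_fixes_one [simp]: "b \<in> carrier B \<Longrightarrow> \<phi> b \<one>\<^bsub>A\<^esub> = \<one>\<^bsub>A\<^esub>"
  using group_hom.hom_one [OF group_hom_action] .

lemma action_inv:
  "\<lbrakk>b \<in> carrier B; a \<in> carrier A\<rbrakk> \<Longrightarrow> \<phi> b (inv\<^bsub>A\<^esub> a) = inv\<^bsub>A\<^esub> (\<phi> b a)"
  using group_hom.hom_inv [OF group_hom_action] .

lemma action_by_one [simp]: "a \<in> carrier A \<Longrightarrow> \<phi> \<one>\<^bsub>B\<^esub> a = a"
  using hom_one [OF action B.is_group A.AutoGroup] by (simp add: AutoGroup_def BijGroup_def)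

lemma carrier_P [simp]: "carrier P = carrier A \<times> carrier B"
  by (simp add: semidirect_product_def)

lemma one_P [simp]: "\<one>\<^bsub>P\<^esub> = (\<one>\<^bsub>A\<^esub>, \<one>\<^bsub>B\<^esub>)"
  by (simp add: semidirect_product_def)

lemma mult_P [simp]:
  "(a, b) \<otimes>\<^bsub>P\<^esub> (a', b') = (a \<otimes>\<^bsub>A\<^esub> \<phi> b a', b \<otimes>\<^bsub>B\<^esub> b')"
  by (simp add: semidirect_product_def)

sublocale P: group P
  by (rule group_semidirect_product) (fact A.is_group B.is_group action)+

lemma group_hom_embed_A: "group_hom A P (\<lambda>a. (a, \<one>\<^bsub>B\<^esub>))"
  by unfold_locales (auto simp: hom_def)

lemma group_hom_embed_B: "group_hom B P (Pair \<one>\<^bsub>A\<^esub>)"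
  by unfold_locales (auto simp: hom_def)

lemma conj_embed:
  assumes "a \<in> carrier A" "b \<in> carrier B"
  shows "(\<one>\<^bsub>A\<^esub>, b) \<otimes>\<^bsub>P\<^esub> (a, \<one>\<^bsub>B\<^esub>) \<otimes>\<^bsub>P\<^esub> inv\<^bsub>P\<^esub> (\<one>\<^bsub>A\<^esub>, b) = (\<phi> b a, \<one>\<^bsub>B\<^esub>)"
  using assms by (simp flip: group_hom.hom_inv [OF group_hom_embed_B])

lemma orbit_subset_carrier: "x \<in> carrier A \<Longrightarrow> Group_Action.orbit B \<phi> x \<subseteq> carrier A"
  by (auto simp: Group_Action.orbit_def)

text \<open>
  Over the copy of B, one point of an orbit is as good as the whole orbit, because the other points are
  its conjugates.
\<close>

lemma generate_semidirect_product:
  assumes x: "x \<in> carrier A" and genA: "generate A (Group_Action.orbit B \<phi> x) = carrier A"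
    and T: "T \<subseteq> carrier B" and genB: "generate B T = carrier B"
  shows "generate P (Pair \<one>\<^bsub>A\<^esub> ` T \<union> {(x, \<one>\<^bsub>B\<^esub>)}) = carrier P"
    (is "generate P ?S = _")
proof
  have S: "?S \<subseteq> carrier P"
    using x T by auto
  interpret H: subgroup "generate P ?S" P
    using S by (rule P.generate_is_subgroup)
  show "generate P ?S \<subseteq> carrier P"
    by (rule H.subset)
  have "Pair \<one>\<^bsub>A\<^esub> ` carrier B \<subseteq> generate P ?S"
    unfolding genB [symmetric] group_hom.generate_img [OF group_hom_embed_B T, symmetric]
    by (rule P.mono_generate) auto
  then have B: "(\<one>\<^bsub>A\<^esub>, b) \<in> generate P ?S" if "b \<in> carrier B" for b
    using that by auto
  have "(\<phi> b x, \<one>\<^bsub>B\<^esub>) \<in> generate P ?S" if "b \<in> carrier B" for b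
    unfolding conj_embed [OF x that, symmetric]
    by (intro H.m_closed H.m_inv_closed B that generate.incl) auto
  then have "(\<lambda>a. (a, \<one>\<^bsub>B\<^esub>)) ` Group_Action.orbit B \<phi> x \<subseteq> generate P ?S"
    by (auto simp: Group_Action.orbit_def)
  then have "(\<lambda>a. (a, \<one>\<^bsub>B\<^esub>)) ` carrier A \<subseteq> generate P ?S"
    unfolding genA [symmetric]
      group_hom.generate_img [OF group_hom_embed_A orbit_subset_carrier [OF x], symmetric]
    by (rule P.generate_subgroup_incl) (rule H.subgroup_axioms)
  then have A: "(a, \<one>\<^bsub>B\<^esub>) \<in> generate P ?S" if "a \<in> carrier A" for a
    using that by auto
  have "(a, b) \<in> generate P ?S" if "a \<in> carrier A" "b \<in> carrier B" for a b
    using H.m_closed [OF A B] that by simp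
  then show "carrier P \<subseteq> generate P ?S"
    by auto
qed

section \<open>The labelling by the orbit map\<close>

lemma bij_betw_orbit:
  assumes "finite (carrier B)" "card (Group_Action.orbit B \<phi> x) = card (carrier B)"
  shows "bij_betw (\<lambda>b. \<phi> b x) (carrier B) (Group_Action.orbit B \<phi> x)"
proof -
  have "(\<lambda>b. \<phi> b x) ` carrier B = Group_Action.orbit B \<phi> x"
    by (auto simp: Group_Action.orbit_def)
  with assms show ?thesis
    by (auto simp: bij_betw_def intro: eq_card_imp_inj_on)
qed

text \<open>Label i at y marks the edge along which \<open>(x, 1)\<close> moves \<open>(y, i)\<close>.\<close>

definition orbit_labelling :: "'a \<Rightarrow> 'a \<Rightarrow> 'b \<Rightarrow> 'a set"
  where "orbit_labelling x y i = {y, y \<otimes>\<^bsub>A\<^esub> \<phi> i x}"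

lemma edge_labelling_orbit:
  assumes "x \<in> carrier A" "finite (carrier B)"
    and "card (Group_Action.orbit B \<phi> x) = card (carrier B)"
  shows "edge_labelling (cayley_graph A (Group_Action.orbit B \<phi> x)) (cayley_graph B T)
    (orbit_labelling x)"
  unfolding edge_labelling_def
proof
  fix y assume "y \<in> pverts (cayley_graph A (Group_Action.orbit B \<phi> x))"
  then have y: "y \<in> carrier A"
    by (simp add: cayley_graph_def)
  show "bij_betw (orbit_labelling x y) (pverts (cayley_graph B T))
      (incident_edges (cayley_graph A (Group_Action.orbit B \<phi> x)) y)"
    using bij_betw_trans [OF bij_betw_orbit [OF assms(2,3)]
        A.bij_betw_incident_edges_cayley_graph [OF orbit_subset_carrier [OF assms(1)] y]]
    by (simp add: cayley_graph_def orbit_labelling_def [abs_def] comp_def)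
qed

lemma arc_cayley_graph_semidirect_product_iff:
  assumes "x \<in> carrier A" "T \<subseteq> carrier B"
  shows "((y, i), (z, j)) \<in> parcs (cayley_graph P (Pair \<one>\<^bsub>A\<^esub> ` T \<union> {(x, \<one>\<^bsub>B\<^esub>)})) \<longleftrightarrow>
    y \<in> carrier A \<and> i \<in> carrier B \<and>
    (y = z \<and> (i, j) \<in> parcs (cayley_graph B T) \<or> z = y \<otimes>\<^bsub>A\<^esub> \<phi> i x \<and> j = i)"
proof -
  have "Pair \<one>\<^bsub>A\<^esub> ` T \<union> {(x, \<one>\<^bsub>B\<^esub>)} \<subseteq> carrier P"
    using assms by auto
  then show ?thesis
    using assms by (auto simp: P.arc_cayley_graph_iff B.arc_cayley_graph_iff)
qed

text \<open>
  The injectivity of the orbit map is what makes labels agree: if the edge from y to z has label i at y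
  and label j at z, then \<open>\<phi> j x\<close> is the inverse of \<open>\<phi> i x\<close>, which is
  \<open>\<phi> i x\<close> again, so \<open>i = j\<close>.
\<close>

lemma cayley_graph_semidirect_product:
  assumes x: "x \<in> carrier A" and x_inv: "inv\<^bsub>A\<^esub> x = x"
    and x_one: "\<one>\<^bsub>A\<^esub> \<notin> Group_Action.orbit B \<phi> x"
    and fin: "finite (carrier B)"
    and card: "card (Group_Action.orbit B \<phi> x) = card (carrier B)"
    and T: "T \<subseteq> carrier B" "\<one>\<^bsub>B\<^esub> \<notin> T"
  shows "cayley_graph P (Pair \<one>\<^bsub>A\<^esub> ` T \<union> {(x, \<one>\<^bsub>B\<^esub>)}) =
    replacement_product (orbit_labelling x)
      (cayley_graph A (Group_Action.orbit B \<phi> x)) (cayley_graph B T)"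
    (is "?C = ?R")
proof -
  have involution: "inv\<^bsub>A\<^esub> (\<phi> i x) = \<phi> i x" if "i \<in> carrier B" for i
    using action_inv [OF that x] x_inv by simp
  have not_one: "\<phi> i x \<noteq> \<one>\<^bsub>A\<^esub>" if "i \<in> carrier B" for i
    using x_one that by (auto simp: Group_Action.orbit_def)
  have reverse_arc: "z = y \<otimes>\<^bsub>A\<^esub> \<phi> i x \<longleftrightarrow> y = z \<otimes>\<^bsub>A\<^esub> \<phi> i x"
    if "i \<in> carrier B" "y \<in> carrier A" "z \<in> carrier A" for i y z
    using A.inv_solve_right' [of y z "\<phi> i x"] that x by (auto simp: involution)
  have between: "z = y \<otimes>\<^bsub>A\<^esub> \<phi> i x \<and> j = i \<longleftrightarrow>
      (y, z) \<in> parcs (cayley_graph A (Group_Action.orbit B \<phi> x)) \<and>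
      orbit_labelling x y i = {y, z} \<and> orbit_labelling x z j = {y, z}"
    if c: "i \<in> carrier B" "j \<in> carrier B" "y \<in> carrier A" "z \<in> carrier A" for i j y z
  proof -
    have "(y, z) \<in> parcs (cayley_graph A (Group_Action.orbit B \<phi> x))"
      if "z = y \<otimes>\<^bsub>A\<^esub> \<phi> i x"
      using that c A.arc_cayley_graph_iff [OF orbit_subset_carrier [OF x]]
      by (auto simp: Group_Action.orbit_def)
    moreover have "j = i" if "z = y \<otimes>\<^bsub>A\<^esub> \<phi> i x" "z = y \<otimes>\<^bsub>A\<^esub> \<phi> j x"
    proof -
      from that c x have "\<phi> j x = \<phi> i x"
        by simp
      then show ?thesis
        using bij_betw_imp_inj_on [OF bij_betw_orbit [OF fin card]] c by (auto dest: inj_onD)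
    qed
    moreover have "orbit_labelling x y i = {y, z} \<longleftrightarrow> z = y \<otimes>\<^bsub>A\<^esub> \<phi> i x"
      unfolding orbit_labelling_def by (metis doubleton_eq_iff)
    moreover have "orbit_labelling x z j = {y, z} \<longleftrightarrow> z = y \<otimes>\<^bsub>A\<^esub> \<phi> j x"
      unfolding orbit_labelling_def reverse_arc [OF c(2-4)] by (metis doubleton_eq_iff)
    ultimately show ?thesis
      by blast
  qed
  have "((y, i), (z, j)) \<in> parcs ?C \<longleftrightarrow> ((y, i), (z, j)) \<in> parcs ?R" for y i z j
  proof (cases "y \<in> carrier A \<and> i \<in> carrier B \<and> z \<in> carrier A \<and> j \<in> carrier B")
    case True
    have "(i, j) \<in> parcs (cayley_graph B T) \<Longrightarrow> i \<noteq> j"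
      using T True by (auto simp: cayley_graph_def)
    moreover have "z = y \<otimes>\<^bsub>A\<^esub> \<phi> i x \<Longrightarrow> y \<noteq> z"
      using True not_one [of i] x by auto
    ultimately show ?thesis
      using True between [of i j y z] arc_cayley_graph_semidirect_product_iff [OF x T(1), of y i z j]
      by (auto simp: replacement_product_def cayley_graph_def)
  next
    case False
    then show ?thesis
      by (auto simp: replacement_product_def cayley_graph_def)
  qed
  then have "parcs ?C = parcs ?R"
    by auto
  moreover have "pverts ?C = pverts ?R"
    by (simp add: cayley_graph_def replacement_product_def)
  ultimately show ?thesis
    by simp
qed

end

section \<open>Cayley graphs of semidirect products as replacement products\<close>

theorem theorem5p4:
  fixes A :: "('a, 'm) monoid_scheme" and B :: "('b, 'n) monoid_scheme"
    and S\<^sub>A :: "'a set" and S\<^sub>B :: "'b set"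
    and \<phi> :: "'b \<Rightarrow> 'a \<Rightarrow> 'a" and x :: 'a and S :: "('a \<times> 'b) set"
  assumes "group A" and "finite (carrier A)"
    and "group B" and "finite (carrier B)"
    and "S\<^sub>A \<subseteq> carrier A" and "generate A S\<^sub>A = carrier A" and "\<one>\<^bsub>A\<^esub> \<notin> S\<^sub>A"
    and "S\<^sub>B \<subseteq> carrier B" and "generate B S\<^sub>B = carrier B" and "\<one>\<^bsub>B\<^esub> \<notin> S\<^sub>B"
    and "card S\<^sub>A = card (carrier B)" and "card (carrier B) \<ge> 2"
    and "\<phi> \<in> hom B (AutoGroup A)"
    and "x \<in> S\<^sub>A" and "S\<^sub>A = Group_Action.orbit B \<phi> x"
    and "S = {(\<one>\<^bsub>A\<^esub>, b) | b. b \<in> S\<^sub>B} \<union> {(x, \<one>\<^bsub>B\<^esub>)}"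
  shows "generate (semidirect_product A \<phi> B) S = carrier (semidirect_product A \<phi> B) \<and>
    (S\<^sub>B = set_inv\<^bsub>B\<^esub> S\<^sub>B \<and> x = inv\<^bsub>A\<^esub> x \<longrightarrow>
      S = set_inv\<^bsub>semidirect_product A \<phi> B\<^esub> S \<and>
      is_replacement_product (cayley_graph (semidirect_product A \<phi> B) S)
        (cayley_graph A S\<^sub>A) (cayley_graph B S\<^sub>B))"
proof (intro conjI impI)
  interpret automorphism_action A B \<phi>
    using assms(1,3,13) by (simp add: automorphism_action_def automorphism_action_axioms_def)
  have x: "x \<in> carrier A"
    using assms(5,14) by blast
  note orbit = assms(15)
  have S: "S = Pair \<one>\<^bsub>A\<^esub> ` S\<^sub>B \<union> {(x, \<one>\<^bsub>B\<^esub>)}"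
    using assms(16) by auto
  show "generate P S = carrier P"
    unfolding S using generate_semidirect_product [OF x _ assms(8,9)] assms(6) orbit by simp
  assume inv: "S\<^sub>B = set_inv\<^bsub>B\<^esub> S\<^sub>B \<and> x = inv\<^bsub>A\<^esub> x"
  have x_inv: "inv\<^bsub>A\<^esub> x = x"
    using inv by simp
  have S\<^sub>B_inv: "inv\<^bsub>B\<^esub> s \<in> S\<^sub>B" if "s \<in> S\<^sub>B" for s
    using inv that unfolding SET_INV_def by blast
  have S\<^sub>A_inv: "inv\<^bsub>A\<^esub> s \<in> S\<^sub>A" if "s \<in> S\<^sub>A" for s
    using that x action_inv x_inv unfolding orbit Group_Action.orbit_def by force
  have "set_inv\<^bsub>P\<^esub> S = Pair \<one>\<^bsub>A\<^esub> ` (set_inv\<^bsub>B\<^esub> S\<^sub>B) \<union> {(inv\<^bsub>A\<^esub> x, \<one>\<^bsub>B\<^esub>)}"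
  proof -
    have "inv\<^bsub>P\<^esub> (\<one>\<^bsub>A\<^esub>, s) = (\<one>\<^bsub>A\<^esub>, inv\<^bsub>B\<^esub> s)" if "s \<in> S\<^sub>B" for s
      using group_hom.hom_inv [OF group_hom_embed_B] assms(8) that by (simp add: subset_iff)
    then show ?thesis
      unfolding S SET_INV_def using group_hom.hom_inv [OF group_hom_embed_A x] by auto
  qed
  then show "S = set_inv\<^bsub>P\<^esub> S"
    using inv S by simp
  show "is_replacement_product (cayley_graph P S) (cayley_graph A S\<^sub>A) (cayley_graph B S\<^sub>B)"
    unfolding is_replacement_product_def
  proof (intro exI conjI)
    show "regular_graph (card S\<^sub>A) (cayley_graph A S\<^sub>A)"
      using assms(2,5,7) S\<^sub>A_inv by (rule A.regular_graph_cayley_graph)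
    show "regular_graph (card S\<^sub>B) (cayley_graph B S\<^sub>B)"
      using assms(4,8,10) S\<^sub>B_inv by (rule B.regular_graph_cayley_graph)
    show "card (pverts (cayley_graph B S\<^sub>B)) = card S\<^sub>A"
      using assms(11) by (simp add: cayley_graph_def)
    show "edge_labelling (cayley_graph A S\<^sub>A) (cayley_graph B S\<^sub>B) (orbit_labelling x)"
      using edge_labelling_orbit [OF x assms(4)] assms(11) orbit by simp
    show "cayley_graph P S =
        replacement_product (orbit_labelling x) (cayley_graph A S\<^sub>A) (cayley_graph B S\<^sub>B)"
      using cayley_graph_semidirect_product [OF x x_inv _ assms(4) _ assms(8,10)] assms(7,11) orbit S
      by simp
  qed
qed

end
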